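(* Let $\mathbb{K}$ be a field of characteristic different from $2$, and let $E$ be the evolution algebra over $\mathbb{K}$ with natural basis $\{e_1,e_2,e_3\}$ and multiplication determined by $e_ie_j=0$ for $i\neq j$ and $$e_1^2=-e_1-e_3,\qquad e_2^2=-2e_1+2e_2,\qquad e_3^2=e_1+e_3.$$ Then $E$ is a three-dimensional non-solvable evolution algebra whose only idempotent is $0$.
   Context: An evolution algebra over a field $\mathbb{K}$ is a commutative, not necessarily associative, $\mathbb{K}$-algebra $E$ admitting a basis $\{e_1,\dots,e_n\}$ (called a natural basis) with $e_ie_j=0$ for all $i\ne j$. For subspaces $U,V$ of an algebra, $UV$ denotes the linear span of the products $uv$ with $u\in U$, $v\in V$. The derived series of an algebra $A$ is $A^{(1)}=A$, $A^{(m+1)}=A^{(m)}A^{(m)}$ for $m\ge1$; $A$ is solvable if $A^{(m)}=0$ for some $m$. An idempotent is an element $x$ with $x^2=x$. *)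

theory Defs
  imports "HOL-Analysis.Cartesian_Space"
begin

text \<open>
  The underlying vector space of an algebra is a whole type \<open>'e\<close>, with the scalar
  multiplication given by a parameter, as in \<^locale>\<open>vector_space\<close>.
\<close>

locale nonassoc_algebra = vector_space scale
  for scale :: "'k::field \<Rightarrow> 'e::ab_group_add \<Rightarrow> 'e" +
  fixes mult :: "'e \<Rightarrow> 'e \<Rightarrow> 'e"
  assumes mult_add_left: "mult (x + y) z = mult x z + mult y z"
    and mult_add_right: "mult x (y + z) = mult x y + mult x z"
    and mult_scale_left: "mult (scale a x) y = scale a (mult x y)"
    and mult_scale_right: "mult x (scale a y) = scale a (mult x y)"
begin

definition product_space :: "'e set \<Rightarrow> 'e set \<Rightarrow> 'e set" where
  "product_space U V = span {mult u v | u v. u \<in> U \<and> v \<in> V}"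

text \<open>The series is indexed from 1; the value at 0 is a dummy.\<close>

fun derived_series :: "nat \<Rightarrow> 'e set" where
  "derived_series 0 = UNIV"
| "derived_series (Suc 0) = UNIV"
| "derived_series (Suc (Suc m)) =
     product_space (derived_series (Suc m)) (derived_series (Suc m))"

definition solvable :: bool where
  "solvable \<longleftrightarrow> (\<exists>m\<ge>1. derived_series m = {0})"

definition idempotent :: "'e \<Rightarrow> bool" where
  "idempotent x \<longleftrightarrow> mult x x = x"

definition natural_basis :: "'e set \<Rightarrow> bool" where
  "natural_basis B \<longleftrightarrow> finite B \<and> independent B \<and> span B = UNIV \<and>
     (\<forall>x\<in>B. \<forall>y\<in>B. x \<noteq> y \<longrightarrow> mult x y = 0)"

end

locale comm_nonassoc_algebra = nonassoc_algebra +
  assumes mult_commute: "mult x y = mult y x"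

locale evolution_algebra = comm_nonassoc_algebra +
  assumes ex_natural_basis: "\<exists>B. natural_basis B"

text \<open>
  Over every field there is an algebra with a natural basis of three elements and the prescribed
  squares, so the hypotheses describing it can be satisfied.
\<close>

lemma ex_algebra_with_natural_basis:
  "\<exists>(mult :: 'k::field ^ 3 \<Rightarrow> 'k ^ 3 \<Rightarrow> 'k ^ 3) e1 e2 e3.
     comm_nonassoc_algebra (*s) mult \<and> distinct [e1, e2, e3] \<and>
     nonassoc_algebra.natural_basis (*s) mult {e1, e2, e3} \<and>
     mult e1 e1 = - e1 - e3 \<and>
     mult e2 e2 = (-2) *s e1 + 2 *s e2 \<and>
     mult e3 e3 = e1 + e3"
proof -
  define e :: "3 \<Rightarrow> 'k ^ 3" where "e = (\<lambda>i. axis i 1)"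
  define mult :: "'k ^ 3 \<Rightarrow> 'k ^ 3 \<Rightarrow> 'k ^ 3" where
    "mult = (\<lambda>x y. (x $ 1 * y $ 1) *s (- e 1 - e 3) + (x $ 2 * y $ 2) *s ((-2) *s e 1 + 2 *s e 2)
       + (x $ 3 * y $ 3) *s (e 1 + e 3))"
  have e_nth: "e i $ j = (if j = i then 1 else 0)" for i j
    by (auto simp: e_def axis_def)
  have alg: "comm_nonassoc_algebra (*s) mult"
    by unfold_locales (simp_all add: mult_def vec_eq_iff algebra_simps)
  then interpret comm_nonassoc_algebra "(*s)" mult .
  have basis: "{e 1, e 2, e 3} = cart_basis"
    unfolding cart_basis_def e_def Setcompr_eq_image UNIV_3 by simp
  have ne: "e i \<noteq> e j" if "i \<noteq> j" for i j
    using that by (metis e_nth zero_neq_one)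
  have "natural_basis {e 1, e 2, e 3}"
    unfolding natural_basis_def
  proof (intro conjI)
    show "vec.independent {e 1, e 2, e 3}" "vec.span {e 1, e 2, e 3} = UNIV"
      unfolding basis by (rule independent_cart_basis, rule span_cart_basis)
  qed (auto simp: mult_def e_nth)
  moreover have "mult (e 1) (e 1) = - e 1 - e 3" "mult (e 2) (e 2) = (-2) *s e 1 + 2 *s e 2"
    "mult (e 3) (e 3) = e 1 + e 3"
    by (simp_all add: mult_def e_nth)
  ultimately show ?thesis
    using alg ne by (intro exI[of _ mult] exI[of _ "e 1"] exI[of _ "e 2"] exI[of _ "e 3"]) simp
qed

end

theory Submission
  imports Defs
begin

text \<open>
  Put \<open>u = e1 + e3\<close> and \<open>v = e2 - e1\<close>. Then \<open>u v = u\<close> and \<open>v v = 2 v - u\<close>, so, \<open>2\<close> being invertible, the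
  span of \<open>u\<close> and \<open>v\<close> is contained in its own product with itself and hence in every term of the
  derived series.

  If \<open>a e1 + b e2 + c e3\<close> is idempotent, comparing coordinates gives \<open>b = 2 b\<^sup>2\<close>, \<open>a = c - b\<close> and
  \<open>c = 2 b c - b\<^sup>2\<close>. When \<open>b \<noteq> 0\<close> we have \<open>2 b = 1\<close>, and the last equation forces \<open>b\<^sup>2 = 0\<close>.
\<close>

lemma two_neq_zero_if_CHAR_neq_2:
  assumes "CHAR('k::idom) \<noteq> 2"
  shows "(2 :: 'k) \<noteq> 0"
proof
  assume "(2 :: 'k) = 0"
  then have "of_nat 2 = (0 :: 'k)" by simp
  then have "CHAR('k) dvd 2" by (simp only: of_nat_eq_0_iff_char_dvd)
  then have "CHAR('k) = 1 \<or> CHAR('k) = 2"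
    by (metis One_nat_def dvd_0_left_iff dvd_imp_le le_antisym less_2_cases not_le
        zero_less_numeral zero_neq_numeral)
  with assms show False by simp
qed

text \<open>The hypotheses are the coordinates of \<open>x = mult x x\<close> at \<open>e1\<close>,
  \<open>e2\<close>, \<open>e3\<close>. The cancellation of \<open>b\<close> yields
  \<open>2 * b = 1\<close>, so no division by 2 occurs.\<close>

lemma idempotent_coords_eq_0:
  fixes a b c :: "'k::idom"
  assumes a: "a = c * c - a * a - 2 * (b * b)" and b: "b = 2 * (b * b)" and c: "c = c * c - a * a"
  shows "a = 0 \<and> b = 0 \<and> c = 0"
proof -
  have ab: "a = c - b" using a b c by simp
  have c': "c = 2 * b * c - b * b" using c unfolding ab by (simp add: algebra_simps)
  have "b = 0"
  proof (rule ccontr)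
    assume "b \<noteq> 0"
    with b have "2 * b = 1" by (metis mult.left_commute mult_cancel_left1)
    \<comment> \<open>With \<open>2 * b = 1\<close>, the equation \<open>c'\<close> reads
      \<open>c = c - b * b\<close>.\<close>
    with c' have "b * b = 0" by simp
    with \<open>b \<noteq> 0\<close> show False by simp
  qed
  with c' ab show ?thesis by simp
qed

context vector_space
begin

lemma span_triple_obtain:
  assumes "x \<in> span {p, q, r}"
  obtains a b c where "x = scale a p + scale b q + scale c r"
proof -
  from assms obtain a b c where "x - scale a p - scale b q - scale c r = 0"
    unfolding span_breakdown_eq span_empty by blast
  then have "x = scale a p + scale b q + scale c r"
    by (simp add: algebra_simps)
  then show thesis by (rule that)
qed

text \<open>Independence concerns the set \<open>{p, q, r}\<close>; distinctness makes the sum over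
  it have three terms and lets \<open>f\<close> assign each vector its own difference of
  coefficients.\<close>

lemma independent_triple_coords_eq:
  assumes ind: "independent {p, q, r}" and dist: "distinct [p, q, r]"
    and eq: "scale a p + scale b q + scale c r = scale a' p + scale b' q + scale c' r"
  shows "a = a' \<and> b = b' \<and> c = c'"
proof -
  define f where "f = (\<lambda>x. if x = p then a - a' else if x = q then b - b' else c - c')"
  have "(\<Sum>x\<in>{p, q, r}. scale (f x) x) = 0"
  proof -
    have "q \<noteq> p" "r \<noteq> p" "r \<noteq> q" using dist by auto
    then show ?thesis
      using dist eq by (simp add: f_def scale_left_diff_distrib algebra_simps)
  qed
  then have "f x = 0" if "x \<in> {p, q, r}" for x
    using ind that independentD[of "{p, q, r}" "{p, q, r}" f x] by blast
  from this[of p] this[of q] this[of r] show ?thesis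
    using dist by (auto simp: f_def)
qed

end

context nonassoc_algebra
begin

lemma mult_zero_left [simp]: "mult 0 x = 0"
  using mult_scale_left[of 0 0 x] by simp

lemma mult_diff_left: "mult (x - y) z = mult x z - mult y z"
  using mult_add_left[of "x - y" y z] by simp

lemma mult_diff_right: "mult x (y - z) = mult x y - mult x z"
  using mult_add_right[of x "y - z" z] by simp

lemma idempotent_zero: "idempotent 0"
  by (simp add: idempotent_def)

lemma mult_in_product_space: "u \<in> U \<Longrightarrow> v \<in> V \<Longrightarrow> mult u v \<in> product_space U V"
  unfolding product_space_def by (intro span_base) blast

text \<open>Products of sets are monotone, so by induction \<open>W\<close> survives in every term
  of the series. Since \<open>W\<close> may be any set, checking generators of a subspace is
  enough.\<close>

lemma not_solvable_if_subset_product_space: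
  assumes sub: "W \<subseteq> product_space W W" and "u \<in> W" "u \<noteq> 0"
  shows "\<not> solvable"
proof -
  have "W \<subseteq> derived_series m" for m
  proof (induction m rule: derived_series.induct)
    case (3 m)
    then have "product_space W W
        \<subseteq> product_space (derived_series (Suc m)) (derived_series (Suc m))"
      unfolding product_space_def by (intro span_mono) blast
    with sub show ?case by auto
  qed auto
  with assms(2,3) show ?thesis unfolding solvable_def by blast
qed

lemma natural_triple_mult_self:
  assumes "natural_basis {p, q, r}" "distinct [p, q, r]"
  shows "mult (scale a p + scale b q + scale c r) (scale a p + scale b q + scale c r) =
    scale (a * a) (mult p p) + scale (b * b) (mult q q) + scale (c * c) (mult r r)"
proof -
  have "mult p q = 0" "mult q p = 0" "mult p r = 0" "mult r p = 0" "mult q r = 0" "mult r q = 0"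
    using assms unfolding natural_basis_def by auto
  then show ?thesis
    by (simp add: mult_add_left mult_add_right mult_scale_left mult_scale_right)
qed

end

theorem corollary2p2:
  fixes scale :: "'k::field \<Rightarrow> 'e::ab_group_add \<Rightarrow> 'e"
    and mult :: "'e \<Rightarrow> 'e \<Rightarrow> 'e"
    and e1 e2 e3 :: 'e
  assumes "CHAR('k) \<noteq> 2"
    and "comm_nonassoc_algebra scale mult"
    and "distinct [e1, e2, e3]"
    and "nonassoc_algebra.natural_basis scale mult {e1, e2, e3}"
    and "mult e1 e1 = - e1 - e3"
    and "mult e2 e2 = scale (-2) e1 + scale 2 e2"
    and "mult e3 e3 = e1 + e3"
  shows "evolution_algebra scale mult \<and>
    vector_space.dim scale (UNIV :: 'e set) = 3 \<and>
    \<not> nonassoc_algebra.solvable scale mult \<and>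
    (\<forall>x. nonassoc_algebra.idempotent mult x \<longleftrightarrow> x = 0)"
proof -
  interpret comm_nonassoc_algebra scale mult by (rule assms(2))
  note dist = assms(3) and basis = assms(4) and squares = assms(5-7)
  have ind: "independent {e1, e2, e3}" and span: "span {e1, e2, e3} = UNIV"
    using basis by (auto simp: natural_basis_def)
  have two: "(2 :: 'k) \<noteq> 0" using assms(1) by (rule two_neq_zero_if_CHAR_neq_2)

  have "evolution_algebra scale mult"
    by unfold_locales (use basis in blast)
  moreover have "dim (UNIV :: 'e set) = 3"
    using dim_span_eq_card_independent[OF ind] dist unfolding span by simp
  moreover have "\<not> solvable"
  proof (rule not_solvable_if_subset_product_space)
    let ?u = "e1 + e3" and ?v = "e2 - e1"
    have orth: "mult e1 e2 = 0" "mult e2 e1 = 0" "mult e3 e1 = 0" "mult e3 e2 = 0"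
      using basis dist unfolding natural_basis_def by auto
    have uv: "mult ?u ?v = ?u"
      by (simp add: mult_add_left mult_diff_right orth squares)
    have "mult ?v ?v = scale 2 ?v - ?u"
      by (simp add: mult_diff_left mult_diff_right orth squares scale_right_diff_distrib)
    \<comment> \<open>Adding \<open>mult ?u ?v = ?u\<close> cancels the \<open>- ?u\<close> in the
      square of \<open>?v\<close> and leaves \<open>scale 2 ?v\<close>; the characteristic enters
      here.\<close>
    then have v: "?v = scale (inverse 2) (mult ?v ?v + mult ?u ?v)"
      using two by (simp add: uv)
    show "{?u, ?v} \<subseteq> product_space {?u, ?v} {?u, ?v}"
    proof -
      let ?P = "product_space {?u, ?v} {?u, ?v}"
      have P: "mult ?u ?v \<in> ?P" "mult ?v ?v \<in> ?P"
        by (simp_all add: mult_in_product_space)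
      then have "scale (inverse 2) (mult ?v ?v + mult ?u ?v) \<in> ?P"
        unfolding product_space_def by (intro span_scale span_add)
      with P(1) show ?thesis unfolding v[symmetric] by (simp add: uv)
    qed
    show "?u \<in> {?u, ?v}" by simp
    show "?u \<noteq> 0"
      \<comment> \<open>The coordinates (1, 0, 1) of \<open>?u\<close> are compared with those of
        0.\<close>
      using independent_triple_coords_eq[OF ind dist, of 1 0 1 0 0 0] by auto
  qed
  moreover have "x = 0" if "idempotent x" for x
  proof -
    obtain a b c where x: "x = scale a e1 + scale b e2 + scale c e3"
      using span_triple_obtain[of x e1 e2 e3] span by auto
    \<comment> \<open>The squares of \<open>e1\<close> and \<open>e3\<close> are opposite, so
      \<open>a\<close> and \<open>c\<close> enter only through \<open>c * c - a * a\<close>.\<close>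
    have "mult x x = scale (c * c - a * a - 2 * (b * b)) e1 + scale (2 * (b * b)) e2
        + scale (c * c - a * a) e3"
      unfolding x natural_triple_mult_self[OF basis dist] squares
      by (simp add: algebra_simps)
    with that have "scale a e1 + scale b e2 + scale c e3 =
        scale (c * c - a * a - 2 * (b * b)) e1 + scale (2 * (b * b)) e2 + scale (c * c - a * a) e3"
      by (simp add: idempotent_def x)
    from independent_triple_coords_eq[OF ind dist this] have "a = 0 \<and> b = 0 \<and> c = 0"
      by (intro idempotent_coords_eq_0) blast+
    then show ?thesis by (simp add: x)
  qed
  ultimately show ?thesis using idempotent_zero by blast
qed

end
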